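(* Consider the finite control model described in the context (finite state space $X$ and finite action set $A$), and suppose that Assumption (I) of the context holds. Then for each fixed discount factor $\alpha>0$, the discounted-cost policy iteration algorithm described in the context, started from an arbitrary stationary policy, stops after a finite number of iterations and yields a discounted-cost optimal stationary policy.
   Context: Finite control model: $X\subset\mathbb N_0\times\mathbb N_0$ is a finite state space containing $(0,0)$, and $A\subset[\gamma,R]$ is a finite nonempty action set, where $0<\gamma\le R<\infty$. For each $a\in A$, $(\pi^a_{xy})_{x,y\in X}$ are conservative transition rates: $\pi^a_{xy}\ge0$ for $x\ne y$ and $\sum_{y\in X}\pi^a_{xy}=0$. The cost rate is $r(n,i,a)=c_0\,i+c_1n+a\,c_2\,\mathbf 1_{\{i>S\}}+c_3\,n\,\mathbf 1_{\{i=0\}}$ with constants $c_0,c_1,c_2,c_3\ge0$, $S\in\mathbb N_0$. Stationary policies are the functions $\beta:X\to A$. For a policy $\beta$, let $Q(\beta)=[\pi^{\beta(x)}_{xy}]_{x,y\in X}$, let $\hat r(\beta)$ be the column vector $[r(x,\beta(x))]_{x\in X}$, let $Y(t)$ be the Markov chain on $X$ with generator $Q(\beta)$, and let $E^\beta_x$ be expectation given $Y(0)=x$. Criterion: $I^\beta_\alpha(x)=E^\beta_x\int_0^\infty e^{-\alpha t}r(Y(t),\beta(Y(t-)))\,dt$; a policy $\beta^*$ is discounted-cost optimal if $I^{\beta^*}_\alpha(x)=\inf_\beta I^\beta_\alpha(x)$ for all $x\in X$, the infimum being over all stationary policies. Assumption (I): there are a function $W\ge1$ on $X$, nondecreasing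 along some enumeration of $X$, and constants $\bar c_1>0$, $\bar b_1\ge0$, $M>0$ such that for all $x\in X$, $a\in A$: $\sum_{y\in X}\pi^a_{xy}W(y)\le-\bar c_1W(x)+\bar b_1\mathbf 1_{\{x=(0,0)\}}$ and $r(x,a)\le M\,W(x)$. Improvement: for a policy $\beta$, $x\in X$, $a\in A$, put $D_\beta(x,a):=r(x,a)+\sum_{y\in X}\pi^a_{xy}I^\beta_\alpha(y)$ and $E_\beta(x):=\{a\in A: D_\beta(x,a)<\alpha I^\beta_\alpha(x)\}$. An improvement policy $\beta'$ of $\beta$ is defined by choosing $\beta'(x)\in E_\beta(x)$ (any choice) if $E_\beta(x)\ne\emptyset$ and $\beta'(x):=\beta(x)$ if $E_\beta(x)=\emptyset$. Discounted-cost policy iteration algorithm: Step 1: pick an arbitrary policy $\beta_0$ and set $k=0$. Step 2: compute $I^{\beta_k}_\alpha=[\alpha\,\mathrm{Id}-Q(\beta_k)]^{-1}\hat r(\beta_k)$. Step 3: let $\beta_{k+1}$ be an improvement policy of $\beta_k$. Step 4: if $\beta_{k+1}=\beta_k$, stop and output $\beta_{k+1}$; otherwise increase $k$ by $1$ and return to Step 2. *)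

theory Defs
  imports "HOL-Probability.Probability"
begin

type_synonym state = "nat \<times> nat"
type_synonym policy = "state \<Rightarrow> real"

definition cost :: "real \<Rightarrow> real \<Rightarrow> real \<Rightarrow> real \<Rightarrow> nat \<Rightarrow> state \<Rightarrow> real \<Rightarrow> real" where
  "cost c0 c1 c2 c3 S x a = (case x of (n, i) \<Rightarrow>
     c0 * real i + c1 * real n + a * c2 * of_bool (i > S) + c3 * real n * of_bool (i = 0))"

text \<open>Policies are extensional functions, so that equality of policies is equality on \<open>X\<close>.\<close>

definition policies :: "state set \<Rightarrow> real set \<Rightarrow> policy set" where
  "policies X A = X \<rightarrow>\<^sub>E A"

text \<open>\<open>\<pi> a x y\<close> is the transition rate from \<open>x\<close> to \<open>y\<close> under the action \<open>a\<close>.\<close>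

definition generator :: "(real \<Rightarrow> state \<Rightarrow> state \<Rightarrow> real) \<Rightarrow> policy \<Rightarrow> state \<Rightarrow> state \<Rightarrow> real" where
  "generator \<pi> \<beta> x y = \<pi> (\<beta> x) x y"

text \<open>The function \<open>P\<close> is a semigroup of stochastic matrices on \<open>X\<close> whose right derivative at
  time 0 is \<open>Q\<close>.\<close>

definition transition_semigroup ::
    "state set \<Rightarrow> (state \<Rightarrow> state \<Rightarrow> real) \<Rightarrow> (real \<Rightarrow> state \<Rightarrow> state \<Rightarrow> real) \<Rightarrow> bool" where
  "transition_semigroup X Q P \<longleftrightarrow>
     (\<forall>t\<ge>0. \<forall>x\<in>X. (\<forall>y\<in>X. P t x y \<ge> 0) \<and> (\<Sum>y\<in>X. P t x y) = 1) \<and>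
     (\<forall>x\<in>X. \<forall>y\<in>X. P 0 x y = of_bool (x = y)) \<and>
     (\<forall>s\<ge>0. \<forall>t\<ge>0. \<forall>x\<in>X. \<forall>z\<in>X. P (s + t) x z = (\<Sum>y\<in>X. P s x y * P t y z)) \<and>
     (\<forall>x\<in>X. \<forall>y\<in>X. ((\<lambda>h. (P h x y - of_bool (x = y)) / h) \<longlongrightarrow> Q x y) (at_right 0))"

text \<open>A time-homogeneous continuous-time Markov chain \<open>(Y t)\<close>, \<open>t \<ge> 0\<close>, on the finite set \<open>X\<close> with
  generator \<open>Q\<close> and initial state \<open>x\<close>, with right-continuous paths having left limits. The topology
  of \<^typ>\<open>nat \<times> nat\<close> is discrete, so the paths are step functions.\<close>

definition markov_chain ::
    "state set \<Rightarrow> (state \<Rightarrow> state \<Rightarrow> real) \<Rightarrow> state \<Rightarrow> 'w measure \<Rightarrow> (real \<Rightarrow> 'w \<Rightarrow> state) \<Rightarrow> bool" where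
  "markov_chain X Q x \<Omega> Y \<longleftrightarrow>
     prob_space \<Omega> \<and>
     (\<forall>t\<ge>0. Y t \<in> measurable \<Omega> (count_space X)) \<and>
     (\<forall>\<omega>\<in>space \<Omega>. \<forall>t\<ge>0. ((\<lambda>s. Y s \<omega>) \<longlongrightarrow> Y t \<omega>) (at_right t)) \<and>
     (\<forall>\<omega>\<in>space \<Omega>. \<forall>t>0. \<exists>l. ((\<lambda>s. Y s \<omega>) \<longlongrightarrow> l) (at_left t)) \<and>
     (AE \<omega> in \<Omega>. Y 0 \<omega> = x) \<and>
     (\<exists>P. transition_semigroup X Q P \<and>
       (\<forall>(n::nat) t y. 0 \<le> t 0 \<and> (\<forall>i\<le>n. t i \<le> t (Suc i)) \<and> (\<forall>i\<le>Suc n. y i \<in> X) \<longrightarrow>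
          measure \<Omega> {\<omega>\<in>space \<Omega>. \<forall>i\<le>Suc n. Y (t i) \<omega> = y i} =
          measure \<Omega> {\<omega>\<in>space \<Omega>. \<forall>i\<le>n. Y (t i) \<omega> = y i} * P (t (Suc n) - t n) (y n) (y (Suc n))))"

text \<open>The value of \<open>Y(t-)\<close> at \<open>t = 0\<close> is immaterial, so that time is left out of the integral.
  For each policy \<open>\<beta>\<close> and initial state \<open>x\<close>, the process \<open>Y \<beta> x\<close> lives on the probability space
  \<open>\<Omega> \<beta> x\<close>.\<close>

definition discounted_cost ::
    "(state \<Rightarrow> real \<Rightarrow> real) \<Rightarrow> real \<Rightarrow> (policy \<Rightarrow> state \<Rightarrow> 'w measure) \<Rightarrow>
     (policy \<Rightarrow> state \<Rightarrow> real \<Rightarrow> 'w \<Rightarrow> state) \<Rightarrow> policy \<Rightarrow> state \<Rightarrow> real" where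
  "discounted_cost r \<alpha> \<Omega> Y \<beta> x =
     (LINT \<omega>|\<Omega> \<beta> x. (LINT t:{0<..}|lborel.
        exp (- \<alpha> * t) * r (Y \<beta> x t \<omega>) (\<beta> (Lim (at_left t) (\<lambda>s. Y \<beta> x s \<omega>)))))"

definition discounted_cost_optimal ::
    "state set \<Rightarrow> real set \<Rightarrow> (policy \<Rightarrow> state \<Rightarrow> real) \<Rightarrow> policy \<Rightarrow> bool" where
  "discounted_cost_optimal X A I \<beta> \<longleftrightarrow>
     \<beta> \<in> policies X A \<and> (\<forall>x\<in>X. I \<beta> x = (INF \<beta>'\<in>policies X A. I \<beta>' x))"

definition assumption_I ::
    "state set \<Rightarrow> real set \<Rightarrow> (real \<Rightarrow> state \<Rightarrow> state \<Rightarrow> real) \<Rightarrow> (state \<Rightarrow> real \<Rightarrow> real) \<Rightarrow> bool" where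
  "assumption_I X A \<pi> r \<longleftrightarrow>
     (\<exists>(W :: state \<Rightarrow> real) c b M.
        (\<forall>x\<in>X. W x \<ge> 1) \<and>
        (\<exists>e. bij_betw e {..<card X} X \<and> mono_on {..<card X} (\<lambda>j. W (e j))) \<and>
        c > 0 \<and> b \<ge> 0 \<and> M > 0 \<and>
        (\<forall>x\<in>X. \<forall>a\<in>A.
           (\<Sum>y\<in>X. \<pi> a x y * W y) \<le> - c * W x + b * of_bool (x = (0, 0)) \<and>
           r x a \<le> M * W x))"

text \<open>In the definitions below, \<open>I \<beta> x\<close> stands for the discounted cost of the policy \<open>\<beta>\<close> started
  in \<open>x\<close>.\<close>

definition improving_actions ::
    "state set \<Rightarrow> real set \<Rightarrow> (real \<Rightarrow> state \<Rightarrow> state \<Rightarrow> real) \<Rightarrow> (state \<Rightarrow> real \<Rightarrow> real) \<Rightarrow> real \<Rightarrow>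
     (policy \<Rightarrow> state \<Rightarrow> real) \<Rightarrow> policy \<Rightarrow> state \<Rightarrow> real set" where
  "improving_actions X A \<pi> r \<alpha> I \<beta> x =
     {a\<in>A. r x a + (\<Sum>y\<in>X. \<pi> a x y * I \<beta> y) < \<alpha> * I \<beta> x}"

definition improvement_policy ::
    "state set \<Rightarrow> real set \<Rightarrow> (real \<Rightarrow> state \<Rightarrow> state \<Rightarrow> real) \<Rightarrow> (state \<Rightarrow> real \<Rightarrow> real) \<Rightarrow> real \<Rightarrow>
     (policy \<Rightarrow> state \<Rightarrow> real) \<Rightarrow> policy \<Rightarrow> policy \<Rightarrow> bool" where
  "improvement_policy X A \<pi> r \<alpha> I \<beta> \<beta>' \<longleftrightarrow>
     \<beta>' \<in> policies X A \<and>
     (\<forall>x\<in>X. if improving_actions X A \<pi> r \<alpha> I \<beta> x \<noteq> {}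
            then \<beta>' x \<in> improving_actions X A \<pi> r \<alpha> I \<beta> x
            else \<beta>' x = \<beta> x)"

text \<open>\<open>B\<close> is the inverse of the square matrix \<open>C\<close> indexed by the finite set \<open>X\<close>.\<close>

definition inverse_matrix_on ::
    "state set \<Rightarrow> (state \<Rightarrow> state \<Rightarrow> real) \<Rightarrow> (state \<Rightarrow> state \<Rightarrow> real) \<Rightarrow> bool" where
  "inverse_matrix_on X C B \<longleftrightarrow>
     (\<forall>x\<in>X. \<forall>z\<in>X. (\<Sum>y\<in>X. C x y * B y z) = of_bool (x = z) \<and>
                  (\<Sum>y\<in>X. B x y * C y z) = of_bool (x = z))"

text \<open>The matrix \<open>\<alpha> Id - Q(\<beta>)\<close> is invertible, and \<open>v\<close> is its inverse applied to the cost vector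
  of \<open>\<beta>\<close>.\<close>

definition policy_evaluation ::
    "state set \<Rightarrow> (real \<Rightarrow> state \<Rightarrow> state \<Rightarrow> real) \<Rightarrow> (state \<Rightarrow> real \<Rightarrow> real) \<Rightarrow> real \<Rightarrow>
     policy \<Rightarrow> (state \<Rightarrow> real) \<Rightarrow> bool" where
  "policy_evaluation X \<pi> r \<alpha> \<beta> v \<longleftrightarrow>
     (\<exists>B. inverse_matrix_on X (\<lambda>x y. \<alpha> * of_bool (x = y) - generator \<pi> \<beta> x y) B \<and>
          (\<forall>x\<in>X. v x = (\<Sum>y\<in>X. B x y * r y (\<beta> y))))"

text \<open>A run of policy iteration is recorded as an infinite sequence of policies. Its entries are
  constrained only as long as the algorithm has not stopped, and are arbitrary afterwards.\<close>

definition policy_iteration_run ::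
    "state set \<Rightarrow> real set \<Rightarrow> (real \<Rightarrow> state \<Rightarrow> state \<Rightarrow> real) \<Rightarrow> (state \<Rightarrow> real \<Rightarrow> real) \<Rightarrow> real \<Rightarrow>
     (policy \<Rightarrow> state \<Rightarrow> real) \<Rightarrow> (nat \<Rightarrow> policy) \<Rightarrow> bool" where
  "policy_iteration_run X A \<pi> r \<alpha> I \<beta> \<longleftrightarrow>
     \<beta> 0 \<in> policies X A \<and>
     (\<forall>k. (\<forall>j<k. \<beta> (Suc j) \<noteq> \<beta> j) \<longrightarrow>
        policy_evaluation X \<pi> r \<alpha> (\<beta> k) (I (\<beta> k)) \<and>
        improvement_policy X A \<pi> r \<alpha> I (\<beta> k) (\<beta> (Suc k)))"

definition stops_at :: "(nat \<Rightarrow> policy) \<Rightarrow> nat \<Rightarrow> bool" where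
  "stops_at \<beta> k \<longleftrightarrow> \<beta> (Suc k) = \<beta> k \<and> (\<forall>j<k. \<beta> (Suc j) \<noteq> \<beta> j)"

end

theory Submission
  imports Defs
begin

text \<open>
  The discounted cost \<open>I \<beta>\<close> is the unique solution \<open>u\<close> of the linear system
  \<open>\<alpha> u - Q(\<beta>) u = r(\<beta>)\<close>. On each path the left limit \<open>Y(t-)\<close> differs from \<open>Y(t)\<close> at countably many
  times only, so by Fubini \<open>I \<beta> x\<close> is the potential \<open>u x\<close>, where \<open>u\<close> is the Laplace transform of
  \<open>P\<^sub>t r(\<beta>)\<close> at \<open>\<alpha>\<close> and \<open>P\<close> is the transition semigroup (lemma \<open>discounted_cost_eq_potential\<close>).
  Comparing \<open>P\<^sub>h u\<close> with \<open>u\<close> for small \<open>h\<close> shows that \<open>u\<close> solves the system (lemma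
  \<open>potential_resolvent_equation\<close>). Uniqueness is a consequence of the minimum principle for
  \<open>\<alpha> Id - Q(\<beta>)\<close> (lemmas \<open>resolvent_positive\<close> and \<open>resolvent_comparison\<close>), which moreover makes
  this matrix invertible with a nonnegative inverse.

  Everything about the algorithm follows from the comparison of solutions. If \<open>\<beta>'\<close> improves \<open>\<beta>\<close>,
  then \<open>\<alpha> I \<beta> - Q(\<beta>') I \<beta> \<ge> r(\<beta>')\<close>, with strict inequality in every state where the action
  changes. Hence \<open>I \<beta>' \<le> I \<beta>\<close>, and the two functions differ if the policies do (lemma
  \<open>improvement_decreases_cost\<close>). No policy is visited twice before the algorithm stops, and there
  are finitely many of them. When the algorithm stops, no action improves \<open>\<beta>\<close>, so
  \<open>\<alpha> I \<beta> - Q(\<beta>'') I \<beta> \<le> r(\<beta>'')\<close> for every policy \<open>\<beta>''\<close>, and comparison gives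
  \<open>I \<beta> \<le> I \<beta>''\<close> (lemma \<open>self_improvement_optimal\<close>).
\<close>

section \<open>Minimum principle for conservative rate matrices\<close>

text \<open>The minimum principle: at a minimum \<open>m\<close> of \<open>v\<close> one has \<open>(Q v) m \<ge> 0\<close>, because the rows of \<open>Q\<close>
  sum to zero and its off-diagonal entries are nonnegative. Hence \<open>\<alpha> v - Q v \<ge> 0\<close> forces
  \<open>v m \<ge> 0\<close>.\<close>

lemma resolvent_positive:
  fixes Q :: "'a \<Rightarrow> 'a \<Rightarrow> real"
  assumes fin: "finite X"
    and off: "\<And>x y. x \<in> X \<Longrightarrow> y \<in> X \<Longrightarrow> x \<noteq> y \<Longrightarrow> 0 \<le> Q x y"
    and cons: "\<And>x. x \<in> X \<Longrightarrow> (\<Sum>y\<in>X. Q x y) = 0"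
    and "\<alpha> > 0"
    and sup: "\<And>x. x \<in> X \<Longrightarrow> (\<Sum>y\<in>X. Q x y * v y) \<le> \<alpha> * v x"
    and x: "x \<in> X"
  shows "0 \<le> v x"
proof -
  have "Min (v ` X) \<in> v ` X" using fin x by (intro Min_in) auto
  then obtain m where "m \<in> X" and "v m = Min (v ` X)" by auto
  then have m: "m \<in> X" "\<And>y. y \<in> X \<Longrightarrow> v m \<le> v y" using fin by simp_all
  have "(\<Sum>y\<in>X. Q m y * v y) = (\<Sum>y\<in>X. Q m y * (v y - v m)) + (\<Sum>y\<in>X. Q m y) * v m"
    by (simp add: right_diff_distrib sum_subtractf sum_distrib_right)
  also have "\<dots> = (\<Sum>y\<in>X. Q m y * (v y - v m))" using cons m by simp
  also have "\<dots> \<ge> 0"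
  proof (rule sum_nonneg)
    fix y assume "y \<in> X"
    then show "0 \<le> Q m y * (v y - v m)" using m off[of m y] by (cases "m = y") auto
  qed
  finally have "0 \<le> \<alpha> * v m" using sup[OF m(1)] by linarith
  then have "0 \<le> v m" using \<open>\<alpha> > 0\<close> by (simp add: zero_le_mult_iff)
  then show ?thesis using m(2)[OF x] by linarith
qed

lemma resolvent_comparison:
  fixes Q :: "'a \<Rightarrow> 'a \<Rightarrow> real"
  assumes fin: "finite X"
    and off: "\<And>x y. x \<in> X \<Longrightarrow> y \<in> X \<Longrightarrow> x \<noteq> y \<Longrightarrow> 0 \<le> Q x y"
    and cons: "\<And>x. x \<in> X \<Longrightarrow> (\<Sum>y\<in>X. Q x y) = 0"
    and \<alpha>: "\<alpha> > 0"
    and le: "\<And>x. x \<in> X \<Longrightarrow> \<alpha> * v x - (\<Sum>y\<in>X. Q x y * v y) \<le> \<alpha> * w x - (\<Sum>y\<in>X. Q x y * w y)"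
    and x: "x \<in> X"
  shows "v x \<le> w x"
proof -
  have "0 \<le> w x - v x"
  proof (rule resolvent_positive[OF fin off cons \<alpha> _ x, where v = "\<lambda>x. w x - v x"])
    show "(\<Sum>y\<in>X. Q z y * (w y - v y)) \<le> \<alpha> * (w z - v z)" if "z \<in> X" for z
      using le[OF that] by (simp add: right_diff_distrib sum_subtractf)
  qed
  then show ?thesis by simp
qed

lemma resolvent_equation_unique:
  fixes Q :: "'a \<Rightarrow> 'a \<Rightarrow> real"
  assumes fin: "finite X"
    and off: "\<And>x y. x \<in> X \<Longrightarrow> y \<in> X \<Longrightarrow> x \<noteq> y \<Longrightarrow> 0 \<le> Q x y"
    and cons: "\<And>x. x \<in> X \<Longrightarrow> (\<Sum>y\<in>X. Q x y) = 0"
    and \<alpha>: "\<alpha> > 0"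
    and eq: "\<And>x. x \<in> X \<Longrightarrow> \<alpha> * v x - (\<Sum>y\<in>X. Q x y * v y) = \<alpha> * w x - (\<Sum>y\<in>X. Q x y * w y)"
    and x: "x \<in> X"
  shows "v x = w x"
proof (rule antisym)
  show "v x \<le> w x" by (rule resolvent_comparison[OF fin off cons \<alpha> eq_refl[OF eq] x])
  show "w x \<le> v x" by (rule resolvent_comparison[OF fin off cons \<alpha> eq_refl[OF eq[symmetric]] x])
qed


section \<open>Potentials of transition semigroups\<close>

text \<open>The function \<open>P\<^sub>t g\<close>: for a Markov chain with transition function \<open>P\<close>, its value at \<open>x\<close> is the
  expectation of \<open>g\<close> at time \<open>t\<close> for the chain started in \<open>x\<close>.\<close>

definition semigroup_action ::
    "state set \<Rightarrow> (real \<Rightarrow> state \<Rightarrow> state \<Rightarrow> real) \<Rightarrow> real \<Rightarrow> (state \<Rightarrow> real) \<Rightarrow> state \<Rightarrow> real" where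
  "semigroup_action X P t g x = (\<Sum>y\<in>X. P t x y * g y)"

lemma semigroup_action_bounded:
  assumes "transition_semigroup X Q P" "t \<ge> 0" "x \<in> X" "\<And>y. y \<in> X \<Longrightarrow> \<bar>g y\<bar> \<le> C"
  shows "\<bar>semigroup_action X P t g x\<bar> \<le> C"
proof -
  have P: "\<And>y. y \<in> X \<Longrightarrow> 0 \<le> P t x y" "(\<Sum>y\<in>X. P t x y) = 1"
    using assms unfolding transition_semigroup_def by auto
  have "\<bar>semigroup_action X P t g x\<bar> \<le> (\<Sum>y\<in>X. \<bar>P t x y * g y\<bar>)"
    unfolding semigroup_action_def by (rule sum_abs)
  also have "\<dots> \<le> (\<Sum>y\<in>X. P t x y * C)"
    using P assms(4) by (intro sum_mono) (auto simp: abs_mult intro!: mult_left_mono)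
  also have "\<dots> = C" using P by (simp flip: sum_distrib_right)
  finally show ?thesis .
qed

lemma semigroup_action_add:
  assumes "transition_semigroup X Q P" "s \<ge> 0" "t \<ge> 0" "x \<in> X"
  shows "semigroup_action X P (s + t) g x = semigroup_action X P s (semigroup_action X P t g) x"
proof -
  have "semigroup_action X P (s + t) g x = (\<Sum>z\<in>X. \<Sum>y\<in>X. P s x y * P t y z * g z)"
    using assms unfolding semigroup_action_def transition_semigroup_def
    by (simp add: sum_distrib_right)
  also have "\<dots> = (\<Sum>y\<in>X. \<Sum>z\<in>X. P s x y * P t y z * g z)" by (rule sum.swap)
  finally show ?thesis by (simp add: semigroup_action_def sum_distrib_left mult.assoc)
qed

lemma transition_semigroup_tendsto_0:
  assumes "transition_semigroup X Q P" "x \<in> X" "y \<in> X"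
  shows "((\<lambda>h. P h x y) \<longlongrightarrow> of_bool (x = y)) (at_right 0)"
proof -
  have "((\<lambda>h. (P h x y - of_bool (x = y)) / h * h + of_bool (x = y)) \<longlongrightarrow> Q x y * 0 + of_bool (x = y))
        (at_right 0)"
    using assms unfolding transition_semigroup_def by (intro tendsto_intros) auto
  moreover have "\<forall>\<^sub>F h in at_right 0. (P h x y - of_bool (x = y)) / h * h + of_bool (x = y) = P h x y"
    by (auto simp: eventually_at_right_field intro!: exI[of _ 1])
  ultimately have "((\<lambda>h. P h x y) \<longlongrightarrow> Q x y * 0 + of_bool (x = y)) (at_right 0)"
    by (rule Lim_transform_eventually)
  then show ?thesis by simp
qed

text \<open>Differentiability of \<open>P\<close> at time 0 gives continuity at all times, uniformly: the increment over
  \<open>[t, t + h]\<close> is \<open>(P\<^sub>h - Id) P\<^sub>t g\<close>, where \<open>P\<^sub>t g\<close> is bounded independently of \<open>t\<close>.\<close>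

lemma semigroup_action_continuous:
  assumes P: "transition_semigroup X Q P" and fin: "finite X" and x: "x \<in> X"
  shows "continuous_on {0..} (\<lambda>t. semigroup_action X P t g x)"
proof -
  define C where "C = (\<Sum>y\<in>X. \<bar>g y\<bar>)"
  have C: "\<bar>g y\<bar> \<le> C" if "y \<in> X" for y
    unfolding C_def using that fin by (intro member_le_sum) auto
  \<comment> \<open>a modulus of continuity from the right, uniform in time\<close>
  define m where "m h = (\<Sum>y\<in>X. \<bar>P h x y - of_bool (x = y)\<bar> * C)" for h
  have incr: "\<bar>semigroup_action X P (h + t) g x - semigroup_action X P t g x\<bar> \<le> m h"
    if "h \<ge> 0" "t \<ge> 0" for h t
  proof -
    have "semigroup_action X P t g x = (\<Sum>y\<in>X. of_bool (x = y) * semigroup_action X P t g y)"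
      using fin x by simp
    then have "semigroup_action X P (h + t) g x - semigroup_action X P t g x
        = (\<Sum>y\<in>X. (P h x y - of_bool (x = y)) * semigroup_action X P t g y)"
      unfolding semigroup_action_add[OF P that x]
      by (simp add: semigroup_action_def[of X P h] left_diff_distrib sum_subtractf)
    also have "\<bar>\<dots>\<bar> \<le> (\<Sum>y\<in>X. \<bar>(P h x y - of_bool (x = y)) * semigroup_action X P t g y\<bar>)"
      by (rule sum_abs)
    also have "\<dots> \<le> m h"
      unfolding m_def abs_mult using semigroup_action_bounded[OF P that(2) _ C]
      by (intro sum_mono mult_left_mono) auto
    finally show ?thesis .
  qed
  have "(m \<longlongrightarrow> (\<Sum>y\<in>X. \<bar>of_bool (x = y) - of_bool (x = y)\<bar> * C)) (at_right 0)"
    unfolding m_def by (intro tendsto_intros transition_semigroup_tendsto_0[OF P x])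
  then have m0: "(m \<longlongrightarrow> 0) (at_right 0)" by simp
  show ?thesis
    unfolding continuous_on_iff
  proof (intro ballI allI impI)
    fix t e :: real assume t: "t \<in> {0..}" and "e > 0"
    then have "\<forall>\<^sub>F h in at_right 0. m h < e" using m0 order_tendstoD(2) by blast
    then obtain d where d: "d > 0" "\<And>h. 0 < h \<Longrightarrow> h < d \<Longrightarrow> m h < e"
      by (auto simp: eventually_at_right_field)
    show "\<exists>d>0. \<forall>s\<in>{0..}. dist s t < d \<longrightarrow>
        dist (semigroup_action X P s g x) (semigroup_action X P t g x) < e"
    proof (intro exI[of _ d] conjI ballI impI d)
      fix s assume s: "s \<in> {0..}" "dist s t < d"
      consider "s = t" | "s < t" | "t < s" by linarith
      then show "dist (semigroup_action X P s g x) (semigroup_action X P t g x) < e"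
      proof cases
        case 2
        then show ?thesis using incr[of "t - s" s] d(2)[of "t - s"] s by (simp add: dist_real_def)
      next
        case 3
        then show ?thesis using incr[of "s - t" t] d(2)[of "s - t"] s t by (simp add: dist_real_def)
      qed (use \<open>e > 0\<close> in simp)
    qed
  qed
qed

text \<open>The \<open>\<alpha>\<close>-potential of \<open>g\<close>, that is, the resolvent of the semigroup at \<open>\<alpha>\<close> applied to \<open>g\<close>.\<close>

definition potential ::
    "state set \<Rightarrow> (real \<Rightarrow> state \<Rightarrow> state \<Rightarrow> real) \<Rightarrow> real \<Rightarrow> (state \<Rightarrow> real) \<Rightarrow> state \<Rightarrow> real" where
  "potential X P \<alpha> g x = (LINT t:{0<..}|lborel. exp (- \<alpha> * t) * semigroup_action X P t g x)"

lemma set_integrable_exp_Ioi: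
  assumes "\<alpha> > (0::real)"
  shows "set_integrable lborel {0<..} (\<lambda>t. exp (- \<alpha> * t))"
proof -
  have "(\<lambda>t. exp (- \<alpha> * t)) absolutely_integrable_on {0..}"
    using integrable_on_exp_minus_to_infinity[OF assms]
    by (intro nonnegative_absolutely_integrable_1) auto
  then have "set_integrable lborel {0..} (\<lambda>t. exp (- \<alpha> * t))"
    unfolding set_integrable_def by (subst (asm) integrable_completion) simp_all
  then show ?thesis by (rule set_integrable_subset) auto
qed

lemma set_integrable_semigroup_action:
  assumes P: "transition_semigroup X Q P" and fin: "finite X" and x: "x \<in> X" and \<alpha>: "\<alpha> > 0"
  shows "set_integrable lborel {0<..} (\<lambda>t. exp (- \<alpha> * t) * semigroup_action X P t g x)"
proof -
  define C where "C = (\<Sum>y\<in>X. \<bar>g y\<bar>)"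
  have C: "\<bar>g y\<bar> \<le> C" if "y \<in> X" for y
    unfolding C_def using that fin by (intro member_le_sum) auto
  show ?thesis
  proof (rule set_integrable_bound)
    show "set_integrable lborel {0<..} (\<lambda>t. exp (- \<alpha> * t) * C)"
      using set_integrable_exp_Ioi[OF \<alpha>] by (intro set_integrable_mult_left) simp
    have "continuous_on {0<..} (\<lambda>t. exp (- \<alpha> * t) * semigroup_action X P t g x)"
      by (intro continuous_intros continuous_on_subset[OF semigroup_action_continuous[OF P fin x]]) auto
    then show "set_borel_measurable lborel {0<..} (\<lambda>t. exp (- \<alpha> * t) * semigroup_action X P t g x)"
      unfolding set_borel_measurable_def measurable_lborel2
      by (intro borel_measurable_continuous_on_indicator) auto
    show "AE t in lborel. t \<in> {0<..} \<longrightarrow>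
        norm (exp (- \<alpha> * t) * semigroup_action X P t g x) \<le> norm (exp (- \<alpha> * t) * C)"
    proof (intro AE_I2 impI)
      fix t :: real assume "t \<in> {0<..}"
      then show "norm (exp (- \<alpha> * t) * semigroup_action X P t g x) \<le> norm (exp (- \<alpha> * t) * C)"
        using semigroup_action_bounded[OF P _ x, of t g C] C by (simp add: abs_mult)
    qed
  qed
qed

text \<open>Applying \<open>P\<^sub>h\<close> to the potential shifts time by \<open>h\<close>: this cuts off the initial stretch
  \<open>[0, h]\<close> of the integral and multiplies the remainder by \<open>exp (\<alpha> * h)\<close>, as the discounting starts
  \<open>h\<close> later.\<close>

lemma semigroup_action_potential:
  assumes P: "transition_semigroup X Q P" and fin: "finite X" and x: "x \<in> X" and \<alpha>: "\<alpha> > 0"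
    and h: "h > 0"
  shows "semigroup_action X P h (potential X P \<alpha> g) x
    = exp (\<alpha> * h) * (potential X P \<alpha> g x
        - integral {0..h} (\<lambda>t. exp (- \<alpha> * t) * semigroup_action X P t g x))"
proof -
  let ?f = "\<lambda>t. semigroup_action X P t g x"
  note int = set_integrable_semigroup_action[OF P fin _ \<alpha>]
  have "semigroup_action X P h (potential X P \<alpha> g) x
      = (\<Sum>y\<in>X. LINT t:{0<..}|lborel. P h x y * (exp (- \<alpha> * t) * semigroup_action X P t g y))"
    by (simp add: semigroup_action_def[of X P h] potential_def)
  also have "\<dots> = (LINT t:{0<..}|lborel. \<Sum>y\<in>X. P h x y * (exp (- \<alpha> * t) * semigroup_action X P t g y))"
    unfolding set_lebesgue_integral_def scaleR_sum_right
    by (intro Bochner_Integration.integral_sum[symmetric])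
       (rule set_integrable_mult_right[OF int, unfolded set_integrable_def])
  also have "\<dots> = (LINT t:{0<..}|lborel. exp (- \<alpha> * t) * ?f (h + t))"
  proof (rule set_lebesgue_integral_cong)
    show "\<forall>t. t \<in> {0<..} \<longrightarrow> (\<Sum>y\<in>X. P h x y * (exp (- \<alpha> * t) * semigroup_action X P t g y))
        = exp (- \<alpha> * t) * ?f (h + t)"
      using h by (simp add: semigroup_action_add[OF P _ _ x] semigroup_action_def[of X P h]
          sum_distrib_left mult.left_commute)
  qed auto
  also have "\<dots> = (LINT t|lborel. exp (\<alpha> * h) * (indicator {h<..} (h + t) * (exp (- \<alpha> * (h + t)) * ?f (h + t))))"
    unfolding set_lebesgue_integral_def
  proof (rule Bochner_Integration.integral_cong)
    fix t
    have "- \<alpha> * t = \<alpha> * h + - \<alpha> * (h + t)" by (simp add: distrib_left)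
    then have "exp (- \<alpha> * t) = exp (\<alpha> * h) * exp (- \<alpha> * (h + t))" by (simp only: exp_add)
    then show "indicator {0<..} t *\<^sub>R (exp (- \<alpha> * t) * ?f (h + t))
        = exp (\<alpha> * h) * (indicator {h<..} (h + t) * (exp (- \<alpha> * (h + t)) * ?f (h + t)))"
      by (simp add: indicator_def)
  qed simp
  also have "\<dots> = exp (\<alpha> * h) * (LINT t:{h<..}|lborel. exp (- \<alpha> * t) * ?f t)"
    using lborel_integral_real_affine[of 1 "\<lambda>t. indicator {h<..} t * (exp (- \<alpha> * t) * ?f t)" h]
    by (simp add: set_lebesgue_integral_def)
  also have "(LINT t:{h<..}|lborel. exp (- \<alpha> * t) * ?f t)
      = potential X P \<alpha> g x - (LINT t:{0<..h}|lborel. exp (- \<alpha> * t) * ?f t)"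
  proof -
    have "{0<..} = {0<..h} \<union> {h<..}" using h by auto
    moreover have "(LINT t:{0<..h} \<union> {h<..}|lborel. exp (- \<alpha> * t) * ?f t)
       = (LINT t:{0<..h}|lborel. exp (- \<alpha> * t) * ?f t) + (LINT t:{h<..}|lborel. exp (- \<alpha> * t) * ?f t)"
      using h by (intro set_integral_Un set_integrable_subset[OF int[OF x]]) auto
    ultimately show ?thesis unfolding potential_def by simp
  qed
  also have "(LINT t:{0<..h}|lborel. exp (- \<alpha> * t) * ?f t) = integral {0<..h} (\<lambda>t. exp (- \<alpha> * t) * ?f t)"
    using h by (intro set_borel_integral_eq_integral(2) set_integrable_subset[OF int[OF x]]) auto
  also have "\<dots> = integral {0..h} (\<lambda>t. exp (- \<alpha> * t) * ?f t)"
    by (intro integral_subset_negligible negligible_subset[OF negligible_sing[of 0]]) auto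
  finally show ?thesis .
qed

text \<open>The potential \<open>u\<close> satisfies \<open>\<alpha> u - Q u = g\<close>: the difference quotient \<open>(P\<^sub>h u - u) / h\<close> tends to
  \<open>Q u\<close> as \<open>h\<close> decreases to 0, and the preceding lemma identifies the limit as \<open>\<alpha> u - g\<close>.\<close>

lemma potential_resolvent_equation:
  assumes P: "transition_semigroup X Q P" and fin: "finite X" and x: "x \<in> X" and \<alpha>: "\<alpha> > 0"
  shows "\<alpha> * potential X P \<alpha> g x - (\<Sum>y\<in>X. Q x y * potential X P \<alpha> g y) = g x"
proof -
  let ?u = "potential X P \<alpha> g"
  let ?\<phi> = "\<lambda>t. exp (- \<alpha> * t) * semigroup_action X P t g x"
  have "((\<lambda>h. integral {0..h} ?\<phi>) has_real_derivative ?\<phi> 0) (at 0 within {0..1})"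
    by (rule integral_has_real_derivative)
       (auto intro!: continuous_intros continuous_on_subset[OF semigroup_action_continuous[OF P fin x]])
  moreover have "?\<phi> 0 = g x"
    using P fin x by (simp add: semigroup_action_def transition_semigroup_def)
  ultimately have "((\<lambda>h. exp (\<alpha> * h) * (?u x - integral {0..h} ?\<phi>)) has_real_derivative
      \<alpha> * ?u x - g x) (at 0 within {0..1})"
    by (auto intro!: derivative_eq_intros)
  then have 1: "((\<lambda>h. (exp (\<alpha> * h) * (?u x - integral {0..h} ?\<phi>) - ?u x) / h) \<longlongrightarrow> \<alpha> * ?u x - g x) (at_right 0)"
    by (simp add: has_field_derivative_iff at_within_Icc_at_right)
  have "((\<lambda>h. \<Sum>y\<in>X. (P h x y - of_bool (x = y)) / h * ?u y) \<longlongrightarrow> (\<Sum>y\<in>X. Q x y * ?u y)) (at_right 0)"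
    using P x unfolding transition_semigroup_def by (intro tendsto_intros) auto
  moreover have "\<forall>\<^sub>F h in at_right 0. (\<Sum>y\<in>X. (P h x y - of_bool (x = y)) / h * ?u y)
      = (exp (\<alpha> * h) * (?u x - integral {0..h} ?\<phi>) - ?u x) / h"
  proof -
    have "(\<Sum>y\<in>X. (P h x y - of_bool (x = y)) / h * ?u y) = (semigroup_action X P h ?u x - ?u x) / h" for h
    proof -
      have "(\<Sum>y\<in>X. (P h x y - of_bool (x = y)) / h * ?u y)
          = (\<Sum>y\<in>X. P h x y * ?u y - of_bool (x = y) * ?u y) / h"
        by (simp add: left_diff_distrib flip: sum_divide_distrib)
      also have "\<dots> = (semigroup_action X P h ?u x - ?u x) / h"
        using fin x by (simp add: semigroup_action_def sum_subtractf)
      finally show ?thesis .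
    qed
    then show ?thesis
      using semigroup_action_potential[OF P fin x \<alpha>]
      by (auto simp: eventually_at_right_field intro!: exI[of _ 1])
  qed
  ultimately have "((\<lambda>h. (exp (\<alpha> * h) * (?u x - integral {0..h} ?\<phi>) - ?u x) / h) \<longlongrightarrow> (\<Sum>y\<in>X. Q x y * ?u y)) (at_right 0)"
    by (rule Lim_transform_eventually)
  with 1 have "\<alpha> * ?u x - g x = (\<Sum>y\<in>X. Q x y * ?u y)"
    by (intro tendsto_unique[OF _ 1]) auto
  then show ?thesis by simp
qed

section \<open>Paths with countably many jumps\<close>

text \<open>A set of reals all of whose points are isolated from the left is countable, since the left-hand
  gaps contain pairwise different rational numbers.\<close>

lemma countable_left_isolated:
  fixes J :: "real set"
  assumes "\<And>t. t \<in> J \<Longrightarrow> \<exists>b<t. {b<..<t} \<inter> J = {}"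
  shows "countable J"
proof -
  obtain b where b: "\<And>t. t \<in> J \<Longrightarrow> b t < t" "\<And>t. t \<in> J \<Longrightarrow> {b t<..<t} \<inter> J = {}"
    using assms by metis
  have "\<forall>t\<in>J. \<exists>q\<in>\<rat>. b t < q \<and> q < t" using b(1) Rats_dense_in_real by blast
  then obtain q where q: "\<And>t. t \<in> J \<Longrightarrow> q t \<in> \<rat>" "\<And>t. t \<in> J \<Longrightarrow> b t < q t" "\<And>t. t \<in> J \<Longrightarrow> q t < t"
    by metis
  have "q s < q t" if "s \<in> J" "t \<in> J" "s < t" for s t
  proof -
    have "s \<le> b t" using that b(2)[of t] by force
    then show ?thesis using q that by fastforce
  qed
  then have "inj_on q J" by (intro linorder_inj_onI) (force, force)
  moreover have "countable (q ` J)"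
    using q(1) by (intro countable_subset[OF _ countable_rat]) auto
  ultimately show ?thesis by (rule countable_image_inj_on[rotated])
qed

lemma eventually_eq_of_tendsto_state:
  fixes p :: "'b \<Rightarrow> state"
  assumes "(p \<longlongrightarrow> l) F"
  shows "\<forall>\<^sub>F s in F. p s = l"
proof -
  have "open ({fst l} \<times> {snd l})" by (intro open_Times discrete_topology_class.open_discrete)
  then have "open {l}" by simp
  from topological_tendstoD[OF assms this] show ?thesis by simp
qed

text \<open>A path with left limits in a discrete space is constant just before each positive time \<open>t\<close>, so that the
  jump times are isolated from the left. No right continuity is needed.\<close>

lemma countable_jump_times:
  fixes p :: "real \<Rightarrow> state"
  assumes left: "\<And>t. t > 0 \<Longrightarrow> \<exists>l. (p \<longlongrightarrow> l) (at_left t)"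
  shows "countable {t. 0 < t \<and> Lim (at_left t) p \<noteq> p t}"
proof (rule countable_left_isolated)
  fix t assume "t \<in> {t. 0 < t \<and> Lim (at_left t) p \<noteq> p t}"
  then have "t > 0" by simp
  then obtain l where "(p \<longlongrightarrow> l) (at_left t)" using left by blast
  then obtain b where b: "b < t" "\<And>s. b < s \<Longrightarrow> s < t \<Longrightarrow> p s = l"
    using eventually_eq_of_tendsto_state[of p l "at_left t"] by (force simp: eventually_at_left_field)
  have "Lim (at_left s) p = p s" if "b < s" "s < t" for s
  proof (rule tendsto_Lim)
    have "\<forall>\<^sub>F u in at_left s. p u = p s"
      using b that by (auto simp: eventually_at_left_field intro!: exI[of _ b])
    then show "(p \<longlongrightarrow> p s) (at_left s)" by (rule tendsto_eventually)
  qed simp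
  then show "\<exists>b<t. {b<..<t} \<inter> {t. 0 < t \<and> Lim (at_left t) p \<noteq> p t} = {}"
    using b(1) by (intro exI[of _ b]) auto
qed

text \<open>Joint measurability of a right-continuous process: sample it at the next point of a grid of
  mesh \<open>1 / (n + 1)\<close> and let \<open>n\<close> tend to infinity. Negative times, where nothing is known about
  \<open>Y\<close>, are removed by the indicator function.\<close>

lemma right_continuous_jointly_measurable:
  fixes f :: "state \<Rightarrow> real" and Y :: "real \<Rightarrow> 'w \<Rightarrow> state"
  assumes Y: "\<And>t. t \<ge> 0 \<Longrightarrow> Y t \<in> measurable \<Omega> (count_space X)"
    and right: "\<And>\<omega> t. \<omega> \<in> space \<Omega> \<Longrightarrow> t \<ge> 0 \<Longrightarrow> ((\<lambda>s. Y s \<omega>) \<longlongrightarrow> Y t \<omega>) (at_right t)"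
  shows "(\<lambda>(\<omega>, t). indicator {0<..} t * f (Y t \<omega>)) \<in> borel_measurable (\<Omega> \<Otimes>\<^sub>M lborel)"
proof -
  \<comment> \<open>the first grid point strictly after \<open>t\<close>, written so that it is nonnegative for every real \<open>t\<close>\<close>
  define s where "s n t = real (nat (\<lfloor>t * real (Suc n)\<rfloor> + 1)) / real (Suc n)" for n t
  have s_lim: "filterlim (\<lambda>n. s n t) (at_right t) sequentially" if "t > 0" for t
    unfolding filterlim_at
  proof
    have s: "s n t = (of_int \<lfloor>t * real (Suc n)\<rfloor> + 1) / real (Suc n)" for n
      using that by (simp add: s_def)
    have lower: "t < s n t" for n
      unfolding s by (subst pos_less_divide_eq) (simp, linarith)
    then show "\<forall>\<^sub>F n in sequentially. s n t \<in> {t<..} \<and> s n t \<noteq> t" by (simp add: less_imp_neq[THEN not_sym])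
    have upper: "s n t \<le> t + 1 / real (Suc n)" for n
    proof -
      have "s n t \<le> (t * real (Suc n) + 1) / real (Suc n)"
        unfolding s by (intro divide_right_mono) auto
      also have "\<dots> = t + 1 / real (Suc n)" by (simp add: field_simps)
      finally show ?thesis .
    qed
    have "(\<lambda>n. t + 1 / real (Suc n)) \<longlonglongrightarrow> t + 0"
      by (rule tendsto_add[OF tendsto_const LIMSEQ_Suc[OF lim_1_over_n]])
    then have lim: "(\<lambda>n. t + 1 / real (Suc n)) \<longlonglongrightarrow> t" by simp
    show "(\<lambda>n. s n t) \<longlonglongrightarrow> t"
      by (rule tendsto_sandwich[OF always_eventually always_eventually tendsto_const lim])
         (use upper lower[THEN less_imp_le] in simp_all)
  qed
  show ?thesis
  proof (rule borel_measurable_LIMSEQ_real)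
    show "(\<lambda>(\<omega>, t). indicator {0<..} t * f (Y (s n t) \<omega>)) \<in> borel_measurable (\<Omega> \<Otimes>\<^sub>M lborel)" for n
    proof -
      have [measurable]: "(\<lambda>\<omega>. f (Y (real k / real (Suc n)) \<omega>)) \<in> borel_measurable \<Omega>" for k
        using measurable_compose[OF Y, of "real k / real (Suc n)" f borel] by simp
      have "(\<lambda>z. f (Y (real (nat (\<lfloor>snd z * real (Suc n)\<rfloor> + 1)) / real (Suc n)) (fst z)))
          \<in> borel_measurable (\<Omega> \<Otimes>\<^sub>M lborel)"
        by (rule measurable_compose_countable[where f = "\<lambda>k z. f (Y (real k / real (Suc n)) (fst z))"])
           measurable
      then show ?thesis by (simp add: case_prod_beta s_def)
    qed
    fix z :: "'w \<times> real" assume z: "z \<in> space (\<Omega> \<Otimes>\<^sub>M lborel)"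
    obtain \<omega> t where zt: "z = (\<omega>, t)" by (cases z)
    show "(\<lambda>n. case z of (\<omega>, t) \<Rightarrow> indicator {0<..} t * f (Y (s n t) \<omega>))
        \<longlonglongrightarrow> (case z of (\<omega>, t) \<Rightarrow> indicator {0<..} t * f (Y t \<omega>))"
    proof (cases "t > 0")
      case True
      then have "((\<lambda>s. Y s \<omega>) \<longlongrightarrow> Y t \<omega>) (at_right t)"
        using z zt by (intro right) (auto simp: space_pair_measure)
      from eventually_eq_of_tendsto_state[OF filterlim_compose[OF this s_lim[OF True]]]
      have "\<forall>\<^sub>F n in sequentially. Y (s n t) \<omega> = Y t \<omega>" .
      then show ?thesis unfolding zt by (intro tendsto_eventually) (simp add: eventually_mono)
    qed (simp add: zt)
  qed
qed

section \<open>Discounted costs as potentials\<close>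

lemma markov_chain_expectation:
  fixes \<Omega> :: "'w measure"
  assumes mc: "markov_chain X Q x \<Omega> Y" and fin: "finite X" and x: "x \<in> X"
  obtains P where "transition_semigroup X Q P"
    and "\<And>t g. t \<ge> 0 \<Longrightarrow> (LINT \<omega>|\<Omega>. g (Y t \<omega>)) = semigroup_action X P t g x"
proof -
  interpret prob_space \<Omega> using mc by (simp add: markov_chain_def)
  have Y [measurable]: "Y t \<in> measurable \<Omega> (count_space X)" if "t \<ge> 0" for t
    using mc that by (simp add: markov_chain_def)
  have start: "AE \<omega> in \<Omega>. Y 0 \<omega> = x" using mc by (simp add: markov_chain_def)
  obtain P where P: "transition_semigroup X Q P"
    and fdd: "\<forall>(n::nat) t y. 0 \<le> t 0 \<and> (\<forall>i\<le>n. t i \<le> t (Suc i)) \<and> (\<forall>i\<le>Suc n. y i \<in> X) \<longrightarrow>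
          prob {\<omega>\<in>space \<Omega>. \<forall>i\<le>Suc n. Y (t i) \<omega> = y i} =
          prob {\<omega>\<in>space \<Omega>. \<forall>i\<le>n. Y (t i) \<omega> = y i} * P (t (Suc n) - t n) (y n) (y (Suc n))"
    using mc unfolding markov_chain_def by (elim conjE exE)
  have ev: "{\<omega>\<in>space \<Omega>. Y t \<omega> = y} \<in> events" if "t \<ge> 0" for t y
  proof -
    have "{\<omega>\<in>space \<Omega>. Y t \<omega> = y} = Y t -` ({y} \<inter> X) \<inter> space \<Omega>"
      using measurable_space[OF Y[OF that]] by auto
    then show ?thesis using measurable_sets[OF Y[OF that], of "{y} \<inter> X"] by simp
  qed
  have law: "prob {\<omega>\<in>space \<Omega>. Y t \<omega> = y} = P t x y" if "t \<ge> 0" "y \<in> X" for t y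
  proof -
    have all: "(\<forall>i\<le>Suc 0. F i) \<longleftrightarrow> F 0 \<and> F (Suc 0)" for F :: "nat \<Rightarrow> bool"
      by (auto simp: le_Suc_eq)
    \<comment> \<open>the one-dimensional law comes from the two-point joint law at the times 0 and \<open>t\<close>\<close>
    have "prob {\<omega>\<in>space \<Omega>. Y t \<omega> = y} = prob {\<omega>\<in>space \<Omega>. Y 0 \<omega> = x \<and> Y t \<omega> = y}"
    proof (rule finite_measure_eq_AE)
      have "{\<omega>\<in>space \<Omega>. Y 0 \<omega> = x \<and> Y t \<omega> = y} = {\<omega>\<in>space \<Omega>. Y 0 \<omega> = x} \<inter> {\<omega>\<in>space \<Omega>. Y t \<omega> = y}"
        by auto
      then show "{\<omega>\<in>space \<Omega>. Y 0 \<omega> = x \<and> Y t \<omega> = y} \<in> events" using ev[of 0] ev[OF that(1)] by auto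
    qed (use start ev[OF that(1)] in auto)
    also have "\<dots> = prob {\<omega>\<in>space \<Omega>. Y 0 \<omega> = x} * P t x y"
      using fdd[THEN spec[of _ 0], THEN spec[of _ "\<lambda>i. if i = 0 then 0 else t"],
          THEN spec[of _ "\<lambda>i. if i = 0 then x else y"]] that x
      by (simp add: all)
    also have "prob {\<omega>\<in>space \<Omega>. Y 0 \<omega> = x} = 1" using start ev[of 0] by (simp add: prob_eq_1)
    finally show ?thesis by simp
  qed
  have "(LINT \<omega>|\<Omega>. g (Y t \<omega>)) = semigroup_action X P t g x" if t: "t \<ge> 0" for t g
  proof -
    have "(LINT \<omega>|\<Omega>. g (Y t \<omega>)) = (LINT \<omega>|\<Omega>. (\<Sum>y\<in>X. indicator {\<omega>\<in>space \<Omega>. Y t \<omega> = y} \<omega> * g y))"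
    proof (rule Bochner_Integration.integral_cong)
      fix \<omega> assume w: "\<omega> \<in> space \<Omega>"
      then have "Y t \<omega> \<in> X" using measurable_space[OF Y[OF t]] by auto
      then show "g (Y t \<omega>) = (\<Sum>y\<in>X. indicator {\<omega>\<in>space \<Omega>. Y t \<omega> = y} \<omega> * g y)"
        using w fin by (simp add: indicator_def of_bool_def if_distrib[where f="\<lambda>a. a * _"] cong: if_cong)
    qed simp
    also have "\<dots> = (\<Sum>y\<in>X. LINT \<omega>|\<Omega>. indicator {\<omega>\<in>space \<Omega>. Y t \<omega> = y} \<omega> * g y)"
      using ev[OF t] by (intro Bochner_Integration.integral_sum) (auto intro!: integrable_mult_left simp: emeasure_eq_measure)
    also have "\<dots> = semigroup_action X P t g x"
      using ev[OF t] law[OF t] by (simp add: semigroup_action_def)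
    finally show ?thesis .
  qed
  with P show ?thesis by (rule that)
qed

text \<open>Along each path, replacing \<open>Y(t-)\<close> by \<open>Y(t)\<close> changes the cost rate only at the countably many
  jump times. The theorem of Fubini then turns the discounted cost into the potential of the cost
  rate of \<open>\<beta>\<close>. The transition function \<open>P\<close> depends on the chain, hence on the initial state
  \<open>x\<close>.\<close>

lemma discounted_cost_eq_potential:
  fixes \<Omega> :: "policy \<Rightarrow> state \<Rightarrow> 'w measure"
  assumes mc: "markov_chain X Q x (\<Omega> \<beta> x) (Y \<beta> x)" and fin: "finite X" and x: "x \<in> X" and \<alpha>: "\<alpha> > 0"
  obtains P where "transition_semigroup X Q P"
    and "discounted_cost r \<alpha> \<Omega> Y \<beta> x = potential X P \<alpha> (\<lambda>y. r y (\<beta> y)) x"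
proof -
  define M where "M = \<Omega> \<beta> x"
  define Z where "Z = Y \<beta> x"
  define g where "g = (\<lambda>y. r y (\<beta> y))"
  have mc: "markov_chain X Q x M Z" using mc by (simp add: M_def Z_def)
  interpret prob_space M using mc by (simp add: markov_chain_def)
  interpret pair_sigma_finite M lborel ..
  have Z: "Z t \<in> measurable M (count_space X)" if "t \<ge> 0" for t
    using mc that by (simp add: markov_chain_def)
  have right: "((\<lambda>s. Z s \<omega>) \<longlongrightarrow> Z t \<omega>) (at_right t)" if "\<omega> \<in> space M" "t \<ge> 0" for \<omega> t
    using mc that by (simp add: markov_chain_def)
  have left: "\<exists>l. ((\<lambda>s. Z s \<omega>) \<longlongrightarrow> l) (at_left t)" if "\<omega> \<in> space M" "t > 0" for \<omega> t
    using mc that by (simp add: markov_chain_def)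
  obtain P where P: "transition_semigroup X Q P"
    and law: "\<And>t g. t \<ge> 0 \<Longrightarrow> (LINT \<omega>|M. g (Z t \<omega>)) = semigroup_action X P t g x"
    by (rule markov_chain_expectation[OF mc fin x]) blast
  define F where "F \<omega> t = exp (- \<alpha> * t) * (indicator {0<..} t * g (Z t \<omega>))" for \<omega> t
  have F_meas [measurable]: "(\<lambda>(\<omega>, t). F \<omega> t) \<in> borel_measurable (M \<Otimes>\<^sub>M lborel)"
  proof -
    note right_continuous_jointly_measurable[where f = g, OF Z right, measurable]
    have "(\<lambda>z. exp (- \<alpha> * snd z) * (case z of (\<omega>, t) \<Rightarrow> indicator {0<..} t * g (Z t \<omega>)))
        \<in> borel_measurable (M \<Otimes>\<^sub>M lborel)"
      by measurable
    then show ?thesis by (simp add: F_def case_prod_beta)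
  qed
  have path: "(LINT t:{0<..}|lborel. exp (- \<alpha> * t) * r (Z t \<omega>) (\<beta> (Lim (at_left t) (\<lambda>s. Z s \<omega>))))
      = (LINT t|lborel. F \<omega> t)" (is "?L = ?R") if w: "\<omega> \<in> space M" for \<omega>
  proof -
    let ?J = "{t. 0 < t \<and> Lim (at_left t) (\<lambda>s. Z s \<omega>) \<noteq> Z t \<omega>}"
    let ?G = "\<lambda>t. indicator {0<..} t *\<^sub>R (exp (- \<alpha> * t) * r (Z t \<omega>) (\<beta> (Lim (at_left t) (\<lambda>s. Z s \<omega>))))"
    have J: "countable ?J" by (rule countable_jump_times[OF left[OF w]])
    have FG: "F \<omega> t = ?G t" if "t \<notin> ?J" for t
      using that by (auto simp: F_def g_def indicator_def)
    have F: "F \<omega> \<in> borel_measurable lborel"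
      using measurable_Pair2[OF F_meas w] by simp
    have G: "?G \<in> borel_measurable lborel"
    proof (rule measurable_discrete_difference[OF F J])
      show "F \<omega> t = ?G t" if "t \<in> space lborel" "t \<notin> ?J" for t using FG[OF that(2)] .
    qed auto
    have "AE t in lborel. t \<notin> ?J"
      by (rule AE_not_in) (rule countable_imp_null_set_lborel[OF J])
    then have "AE t in lborel. ?G t = F \<omega> t"
      by eventually_elim (use FG in simp)
    then show ?thesis unfolding set_lebesgue_integral_def by (intro integral_cong_AE F G)
  qed
  define C where "C = (\<Sum>y\<in>X. \<bar>g y\<bar>)"
  have C: "\<bar>g y\<bar> \<le> C" if "y \<in> X" for y
    unfolding C_def using that fin by (intro member_le_sum) auto
  have F_int: "integrable (M \<Otimes>\<^sub>M lborel) (\<lambda>(\<omega>, t). F \<omega> t)"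
  proof (rule Fubini_integrable)
    have exp_int: "integrable lborel (\<lambda>t. exp (- \<alpha> * t) * (indicator {0<..} t * C))"
      using set_integrable_exp_Ioi[OF \<alpha>] unfolding set_integrable_def
      by (auto dest: integrable_mult_left[of C] simp: mult_ac)
    have bound: "norm (F \<omega> t) \<le> exp (- \<alpha> * t) * (indicator {0<..} t * C)" if "\<omega> \<in> space M" for \<omega> t
      using C measurable_space[OF Z[of t] that] by (auto simp: F_def indicator_def abs_mult)
    show int: "AE \<omega> in M. integrable lborel (\<lambda>t. case (\<omega>, t) of (\<omega>, t) \<Rightarrow> F \<omega> t)"
    proof (rule AE_I2)
      fix \<omega> assume w: "\<omega> \<in> space M"
      show "integrable lborel (\<lambda>t. case (\<omega>, t) of (\<omega>, t) \<Rightarrow> F \<omega> t)"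
        using measurable_Pair2[OF F_meas w] bound[OF w]
        by (intro Bochner_Integration.integrable_bound[OF exp_int]) (auto intro: order_trans[OF _ abs_ge_self])
    qed
    show "integrable M (\<lambda>\<omega>. LINT t|lborel. norm (case (\<omega>, t) of (\<omega>, t) \<Rightarrow> F \<omega> t))"
    proof (rule integrable_const_bound)
      show "AE \<omega> in M. norm (LINT t|lborel. norm (case (\<omega>, t) of (\<omega>, t) \<Rightarrow> F \<omega> t))
          \<le> (LINT t|lborel. exp (- \<alpha> * t) * (indicator {0<..} t * C))"
        using int AE_space
      proof eventually_elim
        case (elim \<omega>)
        then show ?case using bound[OF elim(2)] exp_int
          by (auto intro!: integral_mono)
      qed
    qed measurable
  qed measurable
  have "discounted_cost r \<alpha> \<Omega> Y \<beta> x = (LINT \<omega>|M. (LINT t|lborel. F \<omega> t))"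
    unfolding discounted_cost_def using path
    by (intro Bochner_Integration.integral_cong) (auto simp: M_def Z_def)
  also have "\<dots> = (LINT t|lborel. (LINT \<omega>|M. F \<omega> t))"
    using Fubini_integral[OF F_int] by simp
  also have "\<dots> = potential X P \<alpha> g x"
    unfolding potential_def set_lebesgue_integral_def
  proof (rule Bochner_Integration.integral_cong)
    fix t :: real
    show "(LINT \<omega>|M. F \<omega> t) = indicator {0<..} t *\<^sub>R (exp (- \<alpha> * t) * semigroup_action X P t g x)"
      by (cases "t > 0") (simp_all add: F_def law)
  qed simp
  finally show ?thesis using that[OF P] by (simp add: g_def)
qed

section \<open>Policy evaluation by matrix inversion\<close>

text \<open>The matrix \<open>\<alpha> Id - Q(\<beta>)\<close> has the potentials of the unit vectors as the columns of a right
  inverse. As the matrix is injective, this is also a left inverse.\<close>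

lemma policy_evaluation_of_resolvent_equation:
  assumes fin: "finite X"
    and off: "\<And>x y. x \<in> X \<Longrightarrow> y \<in> X \<Longrightarrow> x \<noteq> y \<Longrightarrow> 0 \<le> generator \<pi> \<beta> x y"
    and cons: "\<And>x. x \<in> X \<Longrightarrow> (\<Sum>y\<in>X. generator \<pi> \<beta> x y) = 0"
    and \<alpha>: "\<alpha> > 0"
    and P: "transition_semigroup X (generator \<pi> \<beta>) P"
    and v: "\<And>x. x \<in> X \<Longrightarrow> \<alpha> * v x - (\<Sum>y\<in>X. generator \<pi> \<beta> x y * v y) = r x (\<beta> x)"
  shows "policy_evaluation X \<pi> r \<alpha> \<beta> v"
proof -
  let ?Q = "generator \<pi> \<beta>"
  let ?C = "\<lambda>x y. \<alpha> * of_bool (x = y) - ?Q x y"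
  define B where "B x z = potential X P \<alpha> (\<lambda>y. of_bool (y = z)) x" for x z
  have C: "(\<Sum>y\<in>X. ?C x y * w y) = \<alpha> * w x - (\<Sum>y\<in>X. ?Q x y * w y)" if "x \<in> X" for x w
    using fin that by (simp add: left_diff_distrib sum_subtractf mult.assoc flip: sum_distrib_left)
  have right: "(\<Sum>y\<in>X. ?C x y * B y z) = of_bool (x = z)" if "x \<in> X" for x z
    unfolding C[OF that] B_def by (rule potential_resolvent_equation[OF P fin that \<alpha>])
  have solve: "(\<Sum>y\<in>X. B x y * f y) = w x"
    if w: "\<And>x. x \<in> X \<Longrightarrow> (\<Sum>y\<in>X. ?C x y * w y) = f x" and "x \<in> X" for f w x
  proof (rule resolvent_equation_unique[OF fin off cons \<alpha> _ \<open>x \<in> X\<close>])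
    fix x assume x: "x \<in> X"
    have "(\<Sum>y\<in>X. ?C x y * (\<Sum>z\<in>X. B y z * f z)) = (\<Sum>y\<in>X. \<Sum>z\<in>X. ?C x y * B y z * f z)"
      by (simp only: sum_distrib_left mult.assoc)
    also have "\<dots> = (\<Sum>z\<in>X. (\<Sum>y\<in>X. ?C x y * B y z) * f z)"
      unfolding sum_distrib_right by (rule sum.swap)
    also have "\<dots> = f x" using fin x by (simp add: right[OF x])
    finally show "\<alpha> * (\<Sum>y\<in>X. B x y * f y) - (\<Sum>y\<in>X. ?Q x y * (\<Sum>z\<in>X. B y z * f z))
        = \<alpha> * w x - (\<Sum>y\<in>X. ?Q x y * w y)"
      using w[OF x] by (simp only: C[OF x])
  qed
  have "inverse_matrix_on X ?C B"
    unfolding inverse_matrix_on_def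
  proof (intro ballI conjI)
    fix x z assume x: "x \<in> X" and z: "z \<in> X"
    show "(\<Sum>y\<in>X. ?C x y * B y z) = of_bool (x = z)" using right[OF x] .
    show "(\<Sum>y\<in>X. B x y * ?C y z) = of_bool (x = z)"
    proof (rule solve[where w = "\<lambda>x. of_bool (x = z)"])
      show "(\<Sum>y\<in>X. ?C x y * of_bool (y = z)) = ?C x z" for x using fin z by simp
    qed (rule x)
  qed
  moreover have "\<forall>x\<in>X. v x = (\<Sum>y\<in>X. B x y * r y (\<beta> y))"
    using v C by (intro ballI solve[symmetric]) simp_all
  ultimately show ?thesis unfolding policy_evaluation_def by blast
qed

section \<open>Improvement steps and termination\<close>

text \<open>A finite control model together with a family of functions \<open>I \<beta>\<close> that solve the evaluation
  equations \<open>\<alpha> I \<beta> - Q(\<beta>) I \<beta> = r(\<beta>)\<close>, assumed both as a linear system and in the form of an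
  inverse matrix. The cost rate \<open>r\<close> is arbitrary, and no Markov chain is
  involved.\<close>

locale evaluated_control_model =
  fixes X :: "state set" and A :: "real set" and \<pi> :: "real \<Rightarrow> state \<Rightarrow> state \<Rightarrow> real"
    and r :: "state \<Rightarrow> real \<Rightarrow> real" and \<alpha> :: real and I :: "policy \<Rightarrow> state \<Rightarrow> real"
  assumes fin: "finite X" and fin_A: "finite A" and \<alpha>: "\<alpha> > 0"
    and off: "\<And>\<beta> x y. \<beta> \<in> policies X A \<Longrightarrow> x \<in> X \<Longrightarrow> y \<in> X \<Longrightarrow> x \<noteq> y \<Longrightarrow> 0 \<le> generator \<pi> \<beta> x y"
    and cons: "\<And>\<beta> x. \<beta> \<in> policies X A \<Longrightarrow> x \<in> X \<Longrightarrow> (\<Sum>y\<in>X. generator \<pi> \<beta> x y) = 0"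
    and resolvent: "\<And>\<beta> x. \<beta> \<in> policies X A \<Longrightarrow> x \<in> X \<Longrightarrow>
      \<alpha> * I \<beta> x - (\<Sum>y\<in>X. generator \<pi> \<beta> x y * I \<beta> y) = r x (\<beta> x)"
    and evaluation: "\<And>\<beta>. \<beta> \<in> policies X A \<Longrightarrow> policy_evaluation X \<pi> r \<alpha> \<beta> (I \<beta>)"
begin

abbreviation "E \<equiv> improving_actions X A \<pi> r \<alpha> I"
abbreviation "improves \<equiv> improvement_policy X A \<pi> r \<alpha> I"

lemma policy_action: "\<beta> \<in> policies X A \<Longrightarrow> x \<in> X \<Longrightarrow> \<beta> x \<in> A"
  unfolding policies_def by (rule PiE_mem)

lemma own_action_not_improving: "\<beta> \<in> policies X A \<Longrightarrow> x \<in> X \<Longrightarrow> \<beta> x \<notin> E \<beta> x"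
  using resolvent[of \<beta> x] by (simp add: improving_actions_def generator_def)

lemma improvement_in_policies: "improves \<beta> \<beta>' \<Longrightarrow> \<beta>' \<in> policies X A"
  by (simp add: improvement_policy_def)

lemma improvement_exists:
  assumes \<beta>: "\<beta> \<in> policies X A"
  shows "\<exists>\<beta>'. improves \<beta> \<beta>'"
proof
  let ?\<beta>' = "\<lambda>x\<in>X. if E \<beta> x \<noteq> {} then SOME a. a \<in> E \<beta> x else \<beta> x"
  have some: "(SOME a. a \<in> E \<beta> x) \<in> E \<beta> x" if "E \<beta> x \<noteq> {}" for x
    using that by (rule some_in_eq[THEN iffD2])
  have "(if E \<beta> x \<noteq> {} then SOME a. a \<in> E \<beta> x else \<beta> x) \<in> A" if "x \<in> X" for x
    using some[of x] policy_action[OF \<beta> that] by (simp add: improving_actions_def)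
  then have "?\<beta>' \<in> policies X A" unfolding policies_def by (intro restrict_PiE_iff[THEN iffD2] ballI)
  then show "improves \<beta> ?\<beta>'" unfolding improvement_policy_def using some by simp
qed

lemma improvement_decreases_cost:
  assumes \<beta>: "\<beta> \<in> policies X A" and imp: "improves \<beta> \<beta>'" and ne: "\<beta>' \<noteq> \<beta>"
  shows "(\<Sum>x\<in>X. I \<beta>' x) < (\<Sum>x\<in>X. I \<beta> x)"
proof -
  note \<beta>' = improvement_in_policies[OF imp]
  have le: "r x (\<beta>' x) + (\<Sum>y\<in>X. \<pi> (\<beta>' x) x y * I \<beta> y) \<le> \<alpha> * I \<beta> x" if x: "x \<in> X" for x
  proof (cases "E \<beta> x = {}")
    case True
    then have "\<beta>' x = \<beta> x" using imp x by (simp add: improvement_policy_def)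
    then show ?thesis using resolvent[OF \<beta> x] by (simp add: generator_def)
  next
    case False
    then have "\<beta>' x \<in> E \<beta> x" using imp x by (auto simp: improvement_policy_def)
    then show ?thesis by (simp add: improving_actions_def)
  qed
  have mono: "I \<beta>' x \<le> I \<beta> x" if x: "x \<in> X" for x
  proof (rule resolvent_comparison[OF fin off[OF \<beta>'] cons[OF \<beta>'] \<alpha> _ x])
    show "\<alpha> * I \<beta>' z - (\<Sum>y\<in>X. generator \<pi> \<beta>' z y * I \<beta>' y)
        \<le> \<alpha> * I \<beta> z - (\<Sum>y\<in>X. generator \<pi> \<beta>' z y * I \<beta> y)" if z: "z \<in> X" for z
      using le[OF z] resolvent[OF \<beta>' z] by (simp add: generator_def)
  qed
  obtain x where x: "x \<in> X" "\<beta>' x \<noteq> \<beta> x"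
    using \<beta> \<beta>' ne unfolding policies_def by (meson PiE_ext)
  then have "\<beta>' x \<in> E \<beta> x" using imp by (auto simp: improvement_policy_def split: if_splits)
  then have strict: "r x (\<beta>' x) + (\<Sum>y\<in>X. \<pi> (\<beta>' x) x y * I \<beta> y) < \<alpha> * I \<beta> x"
    by (simp add: improving_actions_def)
  \<comment> \<open>equality of the two cost functions would contradict the evaluation equation of \<open>\<beta>'\<close> at \<open>x\<close>\<close>
  have "\<exists>y\<in>X. I \<beta>' y \<noteq> I \<beta> y"
  proof (rule ccontr)
    assume "\<not> ?thesis"
    then have eq: "I \<beta>' y = I \<beta> y" if "y \<in> X" for y using that by blast
    have "\<alpha> * I \<beta> x - (\<Sum>y\<in>X. \<pi> (\<beta>' x) x y * I \<beta> y) = r x (\<beta>' x)"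
      using resolvent[OF \<beta>' x(1)] by (simp add: generator_def eq x(1) cong: sum.cong)
    with strict show False by simp
  qed
  then show ?thesis using mono fin by (intro sum_strict_mono_ex1) (auto simp: less_le)
qed

lemma self_improvement_optimal:
  assumes \<beta>: "\<beta> \<in> policies X A" and imp: "improves \<beta> \<beta>"
  shows "discounted_cost_optimal X A I \<beta>"
proof -
  have no_improvement: "E \<beta> x = {}" if "x \<in> X" for x
    using imp own_action_not_improving[OF \<beta> that] that
    by (auto simp: improvement_policy_def split: if_splits)
  have minimal: "I \<beta> x \<le> I \<beta>' x" if \<beta>': "\<beta>' \<in> policies X A" and x: "x \<in> X" for \<beta>' x
  proof (rule resolvent_comparison[OF fin off[OF \<beta>'] cons[OF \<beta>'] \<alpha> _ x])
    fix z assume z: "z \<in> X"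
    have "\<alpha> * I \<beta> z \<le> r z (\<beta>' z) + (\<Sum>y\<in>X. \<pi> (\<beta>' z) z y * I \<beta> y)"
      using no_improvement[OF z] policy_action[OF \<beta>' z] by (force simp: improving_actions_def)
    then show "\<alpha> * I \<beta> z - (\<Sum>y\<in>X. generator \<pi> \<beta>' z y * I \<beta> y)
        \<le> \<alpha> * I \<beta>' z - (\<Sum>y\<in>X. generator \<pi> \<beta>' z y * I \<beta>' y)"
      using resolvent[OF \<beta>' z] by (simp add: generator_def)
  qed
  have "(INF \<beta>'\<in>policies X A. I \<beta>' x) = I \<beta> x" if "x \<in> X" for x
    by (rule cInf_eq_minimum) (use minimal that \<beta> in blast)+
  then show ?thesis using \<beta> by (simp add: discounted_cost_optimal_def)
qed

lemma policy_iteration_run_exists: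
  assumes "\<beta>0 \<in> policies X A"
  shows "\<exists>\<beta>. policy_iteration_run X A \<pi> r \<alpha> I \<beta> \<and> \<beta> 0 = \<beta>0"
proof -
  have "\<exists>\<beta>. \<forall>n. (\<beta> n \<in> policies X A \<and> (n = 0 \<longrightarrow> \<beta> n = \<beta>0)) \<and> improves (\<beta> n) (\<beta> (Suc n))"
  proof (rule dependent_nat_choice)
    show "\<exists>b. b \<in> policies X A \<and> ((0::nat) = 0 \<longrightarrow> b = \<beta>0)" using assms by blast
    fix b :: policy and n :: nat assume "b \<in> policies X A \<and> (n = 0 \<longrightarrow> b = \<beta>0)"
    then show "\<exists>b'. (b' \<in> policies X A \<and> (Suc n = 0 \<longrightarrow> b' = \<beta>0)) \<and> improves b b'"
      using improvement_exists improvement_in_policies by blast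
  qed
  then show ?thesis using evaluation unfolding policy_iteration_run_def by blast
qed

text \<open>A run that never stopped would produce infinitely many policies, pairwise different because
  their total costs strictly decrease.\<close>

lemma policy_iteration_run_stops_optimal:
  assumes run: "policy_iteration_run X A \<pi> r \<alpha> I \<beta>"
  shows "\<exists>k. stops_at \<beta> k \<and> discounted_cost_optimal X A I (\<beta> (Suc k))"
proof -
  have step: "improves (\<beta> k) (\<beta> (Suc k))" if "\<forall>j<k. \<beta> (Suc j) \<noteq> \<beta> j" for k
    using run that by (simp add: policy_iteration_run_def)
  have pol: "\<beta> k \<in> policies X A" if "\<forall>j<k. \<beta> (Suc j) \<noteq> \<beta> j" for k
  proof (cases k)
    case 0
    then show ?thesis using run by (simp add: policy_iteration_run_def)
  next
    case (Suc m)
    then show ?thesis using improvement_in_policies[OF step[of m]] that by simp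
  qed
  have "\<exists>k. \<beta> (Suc k) = \<beta> k"
  proof (rule ccontr)
    assume "\<not> ?thesis"
    then have ne: "\<beta> (Suc k) \<noteq> \<beta> k" for k by blast
    define s where "s k = - (\<Sum>x\<in>X. I (\<beta> k) x)" for k
    have "strict_mono s"
      unfolding strict_mono_Suc_iff s_def using improvement_decreases_cost[OF pol step ne] ne by simp
    then have "inj s" by (rule strict_mono_imp_inj_on)
    then have "inj \<beta>" unfolding s_def inj_def by metis
    moreover have "range \<beta> \<subseteq> policies X A" using pol ne by blast
    moreover have "finite (policies X A)"
      unfolding policies_def using fin fin_A by (intro finite_PiE)
    ultimately show False by (meson finite_subset finite_imageD infinite_UNIV_nat)
  qed
  then obtain k where k: "\<beta> (Suc k) = \<beta> k" "\<forall>j<k. \<beta> (Suc j) \<noteq> \<beta> j"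
    using exists_least_iff[of "\<lambda>k. \<beta> (Suc k) = \<beta> k"] by blast
  moreover have "discounted_cost_optimal X A I (\<beta> (Suc k))"
    using self_improvement_optimal[OF pol[OF k(2)]] step[OF k(2)] k(1) by simp
  ultimately show ?thesis unfolding stops_at_def by blast
qed

end

section \<open>Policy iteration for the discounted cost\<close>

theorem theorem4p2:
  fixes X :: "state set" and A :: "real set" and \<gamma> R c0 c1 c2 c3 \<alpha> :: real and S :: nat
    and \<pi> :: "real \<Rightarrow> state \<Rightarrow> state \<Rightarrow> real"
    and r :: "state \<Rightarrow> real \<Rightarrow> real"
    and \<Omega> :: "policy \<Rightarrow> state \<Rightarrow> 'w measure"
    and Y :: "policy \<Rightarrow> state \<Rightarrow> real \<Rightarrow> 'w \<Rightarrow> state"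
    and I :: "policy \<Rightarrow> state \<Rightarrow> real"
  assumes "finite X" and "(0, 0) \<in> X"
    and "0 < \<gamma>" and "\<gamma> \<le> R"
    and "finite A" and "A \<noteq> {}" and "A \<subseteq> {\<gamma>..R}"
    and "\<And>a x y. a \<in> A \<Longrightarrow> x \<in> X \<Longrightarrow> y \<in> X \<Longrightarrow> x \<noteq> y \<Longrightarrow> \<pi> a x y \<ge> 0"
    and "\<And>a x. a \<in> A \<Longrightarrow> x \<in> X \<Longrightarrow> (\<Sum>y\<in>X. \<pi> a x y) = 0"
    and "c0 \<ge> 0" and "c1 \<ge> 0" and "c2 \<ge> 0" and "c3 \<ge> 0"
    and r_def: "r = cost c0 c1 c2 c3 S"
    and "assumption_I X A \<pi> r"
    and "\<alpha> > 0"
    and chains: "\<And>\<beta> x. \<beta> \<in> policies X A \<Longrightarrow> x \<in> X \<Longrightarrow>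
           markov_chain X (generator \<pi> \<beta>) x (\<Omega> \<beta> x) (Y \<beta> x)"
    and I_def: "I = discounted_cost r \<alpha> \<Omega> Y"
  shows "(\<forall>\<beta>\<in>policies X A. policy_evaluation X \<pi> r \<alpha> \<beta> (I \<beta>)) \<and>
    (\<forall>\<beta>0\<in>policies X A.
       (\<exists>\<beta>. policy_iteration_run X A \<pi> r \<alpha> I \<beta> \<and> \<beta> 0 = \<beta>0) \<and>
       (\<forall>\<beta>. policy_iteration_run X A \<pi> r \<alpha> I \<beta> \<and> \<beta> 0 = \<beta>0 \<longrightarrow>
          (\<exists>k. stops_at \<beta> k \<and> discounted_cost_optimal X A I (\<beta> (Suc k)))))"
proof -
  note fin = \<open>finite X\<close> and \<alpha> = \<open>\<alpha> > 0\<close>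
  have A: "\<beta> x \<in> A" if "\<beta> \<in> policies X A" "x \<in> X" for \<beta> x
    using that unfolding policies_def by (rule PiE_mem)
  have off: "0 \<le> generator \<pi> \<beta> x y" if "\<beta> \<in> policies X A" "x \<in> X" "y \<in> X" "x \<noteq> y" for \<beta> x y
    using assms(8) A that by (simp add: generator_def)
  have cons: "(\<Sum>y\<in>X. generator \<pi> \<beta> x y) = 0" if "\<beta> \<in> policies X A" "x \<in> X" for \<beta> x
    using assms(9) A that by (simp add: generator_def)
  have resolvent: "\<alpha> * I \<beta> x - (\<Sum>y\<in>X. generator \<pi> \<beta> x y * I \<beta> y) = r x (\<beta> x)"
    if \<beta>: "\<beta> \<in> policies X A" and x: "x \<in> X" for \<beta> x
  proof -
    let ?g = "\<lambda>y. r y (\<beta> y)"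
    obtain P where P: "transition_semigroup X (generator \<pi> \<beta>) P"
      by (rule discounted_cost_eq_potential[where \<Omega> = \<Omega> and Y = Y, OF chains[OF \<beta> x] fin x \<alpha>])
    \<comment> \<open>chains with different initial states may a priori have different transition functions, but the
      potential depends on the generator only\<close>
    have "I \<beta> y = potential X P \<alpha> ?g y" if y: "y \<in> X" for y
    proof -
      obtain P' where P': "transition_semigroup X (generator \<pi> \<beta>) P'"
        and "I \<beta> y = potential X P' \<alpha> ?g y"
        unfolding I_def by (rule discounted_cost_eq_potential[where \<Omega> = \<Omega> and Y = Y, OF chains[OF \<beta> y] fin y \<alpha>])
      moreover have "potential X P' \<alpha> ?g y = potential X P \<alpha> ?g y"
      proof (rule resolvent_equation_unique[OF fin off[OF \<beta>] cons[OF \<beta>] \<alpha> _ y])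
        fix z assume z: "z \<in> X"
        show "\<alpha> * potential X P' \<alpha> ?g z - (\<Sum>y\<in>X. generator \<pi> \<beta> z y * potential X P' \<alpha> ?g y)
            = \<alpha> * potential X P \<alpha> ?g z - (\<Sum>y\<in>X. generator \<pi> \<beta> z y * potential X P \<alpha> ?g y)"
          using potential_resolvent_equation[OF P' fin z \<alpha>] potential_resolvent_equation[OF P fin z \<alpha>]
          by (rule trans[OF _ sym])
      qed
      ultimately show ?thesis by simp
    qed
    then show ?thesis using potential_resolvent_equation[OF P fin x \<alpha>, of ?g] x by simp
  qed
  have evaluation: "policy_evaluation X \<pi> r \<alpha> \<beta> (I \<beta>)" if \<beta>: "\<beta> \<in> policies X A" for \<beta>
  proof -
    obtain P where "transition_semigroup X (generator \<pi> \<beta>) P"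
      using discounted_cost_eq_potential[where \<Omega> = \<Omega> and Y = Y, OF chains[OF \<beta> assms(2)] fin assms(2) \<alpha>] by blast
    then show ?thesis
      by (intro policy_evaluation_of_resolvent_equation[OF fin off cons \<alpha> _ resolvent] \<beta>)
  qed
  interpret evaluated_control_model X A \<pi> r \<alpha> I
    using fin \<open>finite A\<close> \<alpha> off cons resolvent evaluation by unfold_locales
  show ?thesis
    using evaluation policy_iteration_run_exists policy_iteration_run_stops_optimal by blast
qed

end
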